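(* Let $\mathcal H$ be a real Hilbert space with norm $\|\cdot\|$, let $\phi\in\Gamma_0(\mathbb R)$ be an even function, set $\varphi=\phi\circ\|\cdot\|\colon\mathcal H\to\left]-\infty,+\infty\right]$, let $\gamma\in\left]0,+\infty\right[$, let $\sigma\in\mathbb R$, and let $x\in\mathcal H$. Set $$\mathcal R=\{(\chi,\nu)\in\mathbb R^2 \mid \chi+\phi^*(\nu)\leq 0\}.$$ Then $\mathcal R$ is a nonempty closed convex set, and the following hold: (i) Suppose that $\sigma+\gamma\phi^*(\|x\|/\gamma)\leq 0$. Then $\operatorname{prox}_{\gamma\widetilde\varphi}(\sigma,x)=(0,0)$. (ii) Suppose that $\sigma>\gamma\phi(0)$ and $x=0$. Then $\operatorname{prox}_{\gamma\widetilde\varphi}(\sigma,x)=(\sigma-\gamma\phi(0),x)$. (iii) Suppose that $\sigma+\gamma\phi^*(\|x\|/\gamma)>0$ and $x\neq 0$, and set $(\chi,\nu)=\operatorname{proj}_{\mathcal R}(\sigma/\gamma,\|x\|/\gamma)$. Then $$\operatorname{prox}_{\gamma\widetilde\varphi}(\sigma,x)=\Big(\sigma-\gamma\chi,\Big(1-\frac{\gamma\nu}{\|x\|}\Big)x\Big).$$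
   Context: For a real Hilbert space $\mathcal H$, $\Gamma_0(\mathcal H)$ is the class of proper lower semicontinuous convex functions from $\mathcal H$ to $\left]-\infty,+\infty\right]$. For $\varphi\in\Gamma_0(\mathcal H)$: the conjugate is $\varphi^*(u)=\sup_{x\in\mathcal H}(\langle x\mid u\rangle-\varphi(x))$; the recession function is $(\operatorname{rec}\varphi)(x)=\sup_{y\in\operatorname{dom}\varphi}(\varphi(x+y)-\varphi(y))$; the perspective of $\varphi$ is $\widetilde\varphi\colon\mathbb R\times\mathcal H\to\left]-\infty,+\infty\right]$ defined by $\widetilde\varphi(\sigma,x)=\sigma\varphi(x/\sigma)$ if $\sigma>0$, $\widetilde\varphi(0,x)=(\operatorname{rec}\varphi)(x)$, and $\widetilde\varphi(\sigma,x)=+\infty$ if $\sigma<0$. The space $\mathbb R\oplus\mathcal H$ is the Hilbert direct sum, with $\langle(\sigma,x)\mid(\tau,y)\rangle=\sigma\tau+\langle x\mid y\rangle$. For $f\in\Gamma_0(\mathcal K)$ with $\mathcal K$ a real Hilbert space, $\operatorname{prox}_f(z)$ is the unique minimizer over $y\in\mathcal K$ of $f(y)+\frac12\|z-y\|^2$; $\operatorname{prox}_{\gamma\widetilde\varphi}$ is taken in $\mathbb R\oplus\mathcal H$. $\operatorname{proj}_{\mathcal R}$ is the Euclidean projection onto $\mathcal R$ in $\mathbb R^2$. *)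

theory Defs
  imports "HOL-Analysis.Analysis"
begin

text \<open>
  Functions into the half-open interval from minus infinity (excluded) to plus infinity (included)
  are total functions into \<^typ>\<open>ereal\<close>; that the value \<^term>\<open>- \<infinity> :: ereal\<close> is not taken is part of
  properness. Real Hilbert spaces are types of class \<^class>\<open>real_inner\<close> and \<^class>\<open>complete_space\<close>.
\<close>

definition dom :: "('a \<Rightarrow> ereal) \<Rightarrow> 'a set" where
  "dom f = {x. f x < \<infinity>}"

definition proper :: "('a \<Rightarrow> ereal) \<Rightarrow> bool" where
  "proper f \<longleftrightarrow> (\<forall>x. f x \<noteq> -\<infinity>) \<and> dom f \<noteq> {}"

definition lower_semicontinuous :: "('a::topological_space \<Rightarrow> ereal) \<Rightarrow> bool" where
  "lower_semicontinuous f \<longleftrightarrow> (\<forall>x. f x \<le> Liminf (nhds x) f)"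

(* The weights lie in the open interval, so 0 * \<infinity> does not occur; for proper f
   (the only use below) the right-hand side never has the form \<infinity> + -\<infinity>. *)
definition convex_ereal :: "('a::real_vector \<Rightarrow> ereal) \<Rightarrow> bool" where
  "convex_ereal f \<longleftrightarrow>
     (\<forall>x y. \<forall>\<alpha>\<in>{0<..<1::real}.
        f (\<alpha> *\<^sub>R x + (1 - \<alpha>) *\<^sub>R y) \<le> ereal \<alpha> * f x + ereal (1 - \<alpha>) * f y)"

definition Gamma0 :: "('a::real_inner \<Rightarrow> ereal) set" where
  "Gamma0 = {f. proper f \<and> lower_semicontinuous f \<and> convex_ereal f}"

definition conjugate :: "('a::real_inner \<Rightarrow> ereal) \<Rightarrow> 'a \<Rightarrow> ereal" where
  "conjugate f u = (SUP x. ereal (inner x u) - f x)"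

definition rec :: "('a::real_vector \<Rightarrow> ereal) \<Rightarrow> 'a \<Rightarrow> ereal" where
  "rec f x = (SUP y\<in>dom f. f (x + y) - f y)"

definition perspective :: "('a::real_vector \<Rightarrow> ereal) \<Rightarrow> real \<times> 'a \<Rightarrow> ereal" where
  "perspective f = (\<lambda>(\<sigma>, x).
     if \<sigma> > 0 then ereal \<sigma> * f (x /\<^sub>R \<sigma>)
     else if \<sigma> = 0 then rec f x
     else \<infinity>)"

(* Definite description: the value is determined only if a minimizer exists and is unique. *)
definition prox :: "('a::real_inner \<Rightarrow> ereal) \<Rightarrow> 'a \<Rightarrow> 'a" where
  "prox f z = (THE p. is_arg_min (\<lambda>y. f y + ereal ((norm (z - y))\<^sup>2 / 2)) (\<lambda>_. True) p)"

end

theory Submission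
  imports Defs
begin

text \<open>
  The set \<open>R\<close> consists of the pairs \<open>(c, u)\<close> such that \<open>t \<mapsto> u t + c\<close> is an affine minorant of
  \<open>\<phi>\<close>, and the perspective of a function in \<open>\<Gamma>\<^sub>0\<close> is the support function of its set of affine
  minorants. Hence \<open>p\<close> is the proximal point of \<open>z\<close> as soon as \<open>w = (z - p) / \<gamma>\<close> is an affine
  minorant of \<open>\<phi> \<circ> \<parallel>\<cdot>\<parallel>\<close> at which the support function in direction \<open>p\<close> is attained. When \<open>w\<close>
  comes from the projection onto \<open>R\<close>, attainment is the normal-cone inequality of the projection,
  carried from the line to the Hilbert space along the direction of \<open>x\<close>.
\<close>

section \<open>Affine minorants and the conjugate\<close>

text \<open>The intercept comes first, so that the pairing of \<open>(c, u)\<close> with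
  \<open>(\<eta>, y)\<close> in the product space is the expression
  \<open>c * \<eta> + inner u y\<close> bounded by the perspective.\<close>

definition affine_minorants :: "('a::real_inner \<Rightarrow> ereal) \<Rightarrow> (real \<times> 'a) set" where
  "affine_minorants f = {(c, u). \<forall>t. ereal (inner t u + c) \<le> f t}"

lemma affine_minorantsD: "(c, u) \<in> affine_minorants f \<Longrightarrow> ereal (inner t u + c) \<le> f t"
  by (auto simp: affine_minorants_def)

lemma conjugate_le_iff: "conjugate f u \<le> ereal c \<longleftrightarrow> (- c, u) \<in> affine_minorants f"
proof -
  have "ereal (inner t u) - f t \<le> ereal c \<longleftrightarrow> ereal (inner t u + - c) \<le> f t" for t
    by (cases "f t") auto
  then show ?thesis
    by (simp add: conjugate_def affine_minorants_def SUP_le_iff)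
qed

lemma add_conjugate_nonpos_iff:
  "ereal c + conjugate f u \<le> 0 \<longleftrightarrow> (c, u) \<in> affine_minorants f"
proof -
  have "ereal c + conjugate f u \<le> 0 \<longleftrightarrow> conjugate f u \<le> ereal (- c)"
    by (cases "conjugate f u") auto
  then show ?thesis
    by (simp add: conjugate_le_iff)
qed

lemma affine_minorants_eq_INT:
  "affine_minorants f = (\<Inter>t. {p. ereal (inner t (snd p) + fst p) \<le> f t})"
  by (auto simp: affine_minorants_def)

text \<open>For fixed \<open>t\<close> the minorant condition is linear in \<open>(c, u)\<close>
  with normal \<open>(1, t)\<close>; infinite values of \<open>a\<close> give the degenerate
  half-spaces. Closedness and convexity of \<open>affine_minorants f\<close> then pass through the
  intersection.\<close>

lemma half_space_cases:
  "{p. ereal (inner t (snd p) + fst p) \<le> a} =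
    (case a of ereal r \<Rightarrow> {p. inner (1, t) p \<le> r} | PInfty \<Rightarrow> UNIV | MInfty \<Rightarrow> {})"
  by (cases a) (auto simp: inner_prod_def add.commute)

lemma closed_affine_minorants: "closed (affine_minorants f)"
  unfolding affine_minorants_eq_INT half_space_cases
  by (intro closed_INT ballI) (auto split: ereal.split simp: closed_halfspace_le)

lemma convex_affine_minorants: "convex (affine_minorants f)"
  unfolding affine_minorants_eq_INT half_space_cases
  by (intro convex_INT ballI) (auto split: ereal.split simp: convex_halfspace_le)

section \<open>Epigraphs and separating hyperplanes\<close>

text \<open>If the limit lay strictly below the graph, a real \<open>c\<close> strictly between
  \<open>s\<close> and \<open>f t\<close> would eventually separate the heights from the values of
  \<open>f\<close> along the sequence.\<close>

lemma closed_epigraph: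
  fixes f :: "'a::first_countable_topology \<Rightarrow> ereal"
  assumes "lower_semicontinuous f"
  shows "closed {(t, s). f t \<le> ereal s}"
  unfolding closed_sequential_limits
proof (intro allI impI, elim conjE)
  fix X :: "nat \<Rightarrow> 'a \<times> real" and l
  assume X: "\<forall>n. X n \<in> {(t, s). f t \<le> ereal s}" and lim: "X \<longlonglongrightarrow> l"
  obtain t s where l: "l = (t, s)" by (cases l)
  have lim1: "(\<lambda>n. fst (X n)) \<longlonglongrightarrow> t" and lim2: "(\<lambda>n. snd (X n)) \<longlonglongrightarrow> s"
    using tendsto_fst[OF lim] tendsto_snd[OF lim] l by auto
  have "f t \<le> ereal s"
  proof (rule ccontr)
    assume "\<not> f t \<le> ereal s"
    then obtain c where c: "s < c" "ereal c < f t"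
      using ereal_dense2[of "ereal s" "f t"] by (auto simp: not_le)
    have "eventually (\<lambda>y. ereal c < f y) (nhds t)"
      using assms c(2) unfolding lower_semicontinuous_def le_Liminf_iff by blast
    then have "eventually (\<lambda>n. ereal c < f (fst (X n))) sequentially"
      using lim1 by (auto simp: filterlim_iff)
    moreover have "eventually (\<lambda>n. snd (X n) < c) sequentially"
      using lim2 c(1) by (auto simp: order_tendsto_iff)
    ultimately have "eventually (\<lambda>n. False) sequentially"
    proof eventually_elim
      case (elim n)
      have "f (fst (X n)) \<le> ereal (snd (X n))"
        using X by (auto simp: case_prod_beta)
      then have "ereal c < ereal (snd (X n))"
        using elim by order
      with elim show ?case by simp
    qed
    then show False by simp
  qed
  then show "l \<in> {(t, s). f t \<le> ereal s}"
    by (simp add: l)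
qed

lemma convex_epigraph:
  assumes "convex_ereal f"
  shows "convex {(t, s). f t \<le> ereal s}"
  unfolding convex_contains_open_segment
proof (intro ballI subsetI)
  fix p q w :: "'a \<times> real"
  assume pq: "p \<in> {(t, s). f t \<le> ereal s}" "q \<in> {(t, s). f t \<le> ereal s}"
    and w: "w \<in> open_segment p q"
  obtain t s t' s' where eqs: "q = (t, s)" "p = (t', s')" by (cases p, cases q)
  obtain a where a: "a \<in> {0<..<1}" and w: "w = (1 - a) *\<^sub>R p + a *\<^sub>R q"
    using w by (auto simp: in_segment)
  have "f (a *\<^sub>R t + (1 - a) *\<^sub>R t') \<le> ereal a * f t + ereal (1 - a) * f t'"
    using assms a unfolding convex_ereal_def by blast
  also have "\<dots> \<le> ereal a * ereal s + ereal (1 - a) * ereal s'"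
    using pq a by (intro add_mono ereal_mult_left_mono) (auto simp: eqs)
  finally show "w \<in> {(t, s). f t \<le> ereal s}"
    by (simp add: w eqs add.commute)
qed

lemma separate_epigraph:
  fixes f :: "'a::euclidean_space \<Rightarrow> ereal"
  assumes f: "f \<in> Gamma0" and r: "ereal r < f x"
  obtains a \<beta> b where "inner a x + \<beta> * r < b" "\<beta> \<ge> 0"
    "\<And>t s. f t \<le> ereal s \<Longrightarrow> b < inner a t + \<beta> * s"
proof -
  let ?E = "{(t, s). f t \<le> ereal s}"
  have "convex ?E" "closed ?E"
    using f by (auto simp: Gamma0_def intro: convex_epigraph closed_epigraph)
  moreover have "(x, r) \<notin> ?E" using r by auto
  ultimately obtain w b where w: "inner w (x, r) < b" "\<forall>p\<in>?E. inner w p > b"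
    using separating_hyperplane_closed_point by blast
  obtain a \<beta> where ab: "w = (a, \<beta>)" by (cases w)
  have sep: "b < inner a t + \<beta> * s" if "f t \<le> ereal s" for t s
    using w(2) that by (auto simp: ab)
  obtain t0 where "f t0 < \<infinity>" "f t0 \<noteq> - \<infinity>"
    using f by (auto simp: Gamma0_def proper_def dom_def)
  then obtain s0 where s0: "f t0 = ereal s0" by (cases "f t0") auto
  have "\<beta> \<ge> 0"
  proof (rule ccontr)
    assume "\<not> \<beta> \<ge> 0"
    \<comment> \<open>A negative \<open>\<beta>\<close> is refuted by climbing above
      \<open>t0\<close> to a height where the functional has dropped to \<open>b\<close> or
      below.\<close>
    define s where "s = max s0 ((b - inner a t0) / \<beta>)"
    have "b < inner a t0 + \<beta> * s"
      by (rule sep) (simp add: s0 s_def)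
    moreover have "(b - inner a t0) / \<beta> \<le> s" by (simp add: s_def)
    then have "\<beta> * s \<le> b - inner a t0"
      using \<open>\<not> \<beta> \<ge> 0\<close> by (simp add: field_simps)
    ultimately show False by simp
  qed
  with sep w(1) that show ?thesis by (auto simp: ab)
qed

text \<open>Since \<open>\<beta> > 0\<close>, the separation inequality can be solved for the height
  \<open>s\<close>, which makes the hyperplane the graph of an affine function below
  \<open>f\<close>.\<close>

lemma non_vertical_minorant:
  fixes f :: "'a::real_inner \<Rightarrow> ereal"
  assumes "proper f" "\<beta> > 0" and sep: "\<And>t s. f t \<le> ereal s \<Longrightarrow> b < inner a t + \<beta> * s"
  shows "(b / \<beta>, - a /\<^sub>R \<beta>) \<in> affine_minorants f"
proof -
  have "ereal (inner t (- a /\<^sub>R \<beta>) + b / \<beta>) \<le> f t" for t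
  proof (cases "f t")
    case (real s)
    with sep[of t s] \<open>\<beta> > 0\<close> show ?thesis
      by (simp add: field_simps inner_commute)
  qed (use assms(1) in \<open>auto simp: proper_def\<close>)
  then show ?thesis by (auto simp: affine_minorants_def)
qed

section \<open>Existence of affine minorants and Fenchel--Moreau\<close>

lemma affine_minorants_nonempty:
  fixes f :: "'a::euclidean_space \<Rightarrow> ereal"
  assumes f: "f \<in> Gamma0"
  shows "affine_minorants f \<noteq> {}"
proof -
  have "proper f" using f by (simp add: Gamma0_def)
  then obtain t0 where "f t0 < \<infinity>" "f t0 \<noteq> - \<infinity>"
    by (auto simp: proper_def dom_def)
  then obtain s0 where s0: "f t0 = ereal s0" by (cases "f t0") auto
  \<comment> \<open>The separated point lies one unit below the graph over \<open>t0\<close>;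
    comparing both sides of the separation at this same \<open>t0\<close> leaves
    \<open>\<beta> > 0\<close>.\<close>
  then have "ereal (s0 - 1) < f t0" by simp
  then obtain a \<beta> b where ab: "inner a t0 + \<beta> * (s0 - 1) < b" "\<beta> \<ge> 0"
    "\<And>t s. f t \<le> ereal s \<Longrightarrow> b < inner a t + \<beta> * s"
    using separate_epigraph[OF f] by metis
  have "\<beta> > 0"
    using ab(1) ab(3)[of t0 s0] by (simp add: s0 algebra_simps)
  then show ?thesis
    using non_vertical_minorant[OF \<open>proper f\<close> _ ab(3)] by blast
qed

text \<open>The Fenchel--Moreau theorem, phrased without the biconjugate. A vertical separating hyperplane
  is tilted by adding a large multiple of it to some affine minorant.\<close>

lemma Gamma0_le_iff_minorants_le:
  fixes f :: "'a::euclidean_space \<Rightarrow> ereal"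
  assumes f: "f \<in> Gamma0"
  shows "f x \<le> ereal r \<longleftrightarrow> (\<forall>(c, u) \<in> affine_minorants f. inner x u + c \<le> r)"
proof
  assume "f x \<le> ereal r"
  then show "\<forall>(c, u) \<in> affine_minorants f. inner x u + c \<le> r"
    using affine_minorantsD[of _ _ f x] by (fastforce dest: order_trans)
next
  have "proper f" using f by (simp add: Gamma0_def)
  assume le: "\<forall>(c, u) \<in> affine_minorants f. inner x u + c \<le> r"
  show "f x \<le> ereal r"
  proof (rule ccontr)
    assume "\<not> f x \<le> ereal r"
    then obtain a \<beta> b where ab: "inner a x + \<beta> * r < b" "\<beta> \<ge> 0"
      and sep: "\<And>t s. f t \<le> ereal s \<Longrightarrow> b < inner a t + \<beta> * s"
      using separate_epigraph[OF f, of r x] by (metis not_le)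
    show False
    proof (cases "\<beta> = 0")
      case False
      with ab have "\<beta> > 0" by simp
      then have "inner x (- a /\<^sub>R \<beta>) + b / \<beta> \<le> r"
        using le non_vertical_minorant[OF \<open>proper f\<close> _ sep] by blast
      with ab(1) \<open>\<beta> > 0\<close> show False by (simp add: field_simps inner_commute)
    next
      case True
      obtain c0 u0 where m: "(c0, u0) \<in> affine_minorants f"
        using affine_minorants_nonempty[OF f] by auto
      have pos: "b - inner a x > 0" using ab(1) True by simp
      \<comment> \<open>The tilt raises the minorant at \<open>x\<close> by
        \<open>k * (b - inner a x)\<close>; this \<open>k\<close> makes the gain exceed the deficit
        \<open>r - (inner x u0 + c0)\<close> by at least one.\<close>
      define k where "k = (\<bar>r - inner x u0 - c0\<bar> + 1) / (b - inner a x)"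
      have "k \<ge> 0" using pos by (simp add: k_def)
      have "ereal (inner t (u0 - k *\<^sub>R a) + (c0 + k * b)) \<le> f t" for t
      proof (cases "f t")
        case (real s)
        have "inner t u0 + c0 \<le> s"
          using affine_minorantsD[OF m, of t] real by simp
        moreover have "k * b \<le> k * inner a t"
          using sep[of t s] real True \<open>k \<ge> 0\<close> by (intro mult_left_mono) auto
        ultimately show ?thesis
          using real by (simp add: inner_diff_right inner_commute)
      qed (use \<open>proper f\<close> in \<open>auto simp: proper_def\<close>)
      then have "(c0 + k * b, u0 - k *\<^sub>R a) \<in> affine_minorants f"
        by (auto simp: affine_minorants_def)
      then have "inner x (u0 - k *\<^sub>R a) + (c0 + k * b) \<le> r"
        using le by blast
      moreover have "k * (b - inner a x) = \<bar>r - inner x u0 - c0\<bar> + 1"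
        using pos by (simp add: k_def)
      ultimately show False
        by (simp add: inner_diff_right inner_commute algebra_simps)
    qed
  qed
qed

section \<open>Lower bound for the perspective and a proximal point criterion\<close>

text \<open>In the case of a vanishing scale, the increments of \<open>f\<close> along the ray from a point of the
  domain in direction \<open>y\<close> are bounded by the recession function, so telescoping controls the
  slope of every affine minorant.\<close>

lemma perspective_ge:
  fixes f :: "'a::real_inner \<Rightarrow> ereal"
  assumes "proper f" and m: "(c, u) \<in> affine_minorants f"
  shows "ereal (c * \<eta> + inner u y) \<le> perspective f (\<eta>, y)"
proof -
  consider "\<eta> > 0" | "\<eta> = 0" | "\<eta> < 0" by linarith
  then show ?thesis
  proof cases
    case 1
    have "ereal (c * \<eta> + inner u y) = ereal \<eta> * ereal (inner (y /\<^sub>R \<eta>) u + c)"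
      using 1 by (simp add: field_simps inner_commute)
    also have "\<dots> \<le> ereal \<eta> * f (y /\<^sub>R \<eta>)"
      using 1 affine_minorantsD[OF m] by (intro ereal_mult_left_mono) (auto simp del: inner_scaleR_left)
    finally show ?thesis using 1 by (simp add: perspective_def)
  next
    case 2
    have "ereal (inner u y) \<le> rec f y"
    proof (rule ccontr)
      assume "\<not> ereal (inner u y) \<le> rec f y"
      then obtain r where r: "rec f y < ereal r" "r < inner u y"
        using ereal_dense2[of "rec f y" "ereal (inner u y)"] by (auto simp: not_le)
      obtain v where "f v < \<infinity>" "f v \<noteq> - \<infinity>"
        using \<open>proper f\<close> by (auto simp: proper_def dom_def)
      then obtain s where s: "f v = ereal s" by (cases "f v") auto
      have step: "f (y + t) \<le> ereal (s' + r)" if "f t \<le> ereal s'" for t s'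
      proof -
        have "f t \<noteq> - \<infinity>" using \<open>proper f\<close> by (simp add: proper_def)
        moreover have "t \<in> dom f" using that by (auto simp: dom_def)
        then have "f (y + t) - f t \<le> rec f y"
          unfolding rec_def by (rule SUP_upper)
        then have "f (y + t) - f t \<le> ereal r" using r(1) by order
        ultimately show ?thesis using that
          by (cases "f t"; cases "f (y + t)") auto
      qed
      have le: "f (v + real n *\<^sub>R y) \<le> ereal (s + n * r)" for n :: nat
      proof (induction n)
        case 0
        then show ?case by (simp add: s)
      next
        case (Suc n)
        from step[OF this] show ?case by (simp add: algebra_simps)
      qed
      \<comment> \<open>Each step along the ray raises the minorant by \<open>inner u y\<close> but
        the bound on \<open>f\<close> only by \<open>r\<close>, so the surplus eventually exceeds
        any constant.\<close>
      have bound: "real n * (inner u y - r) \<le> s - c - inner u v" for n :: nat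
        using order_trans[OF affine_minorantsD[OF m] le[of n]]
        by (simp add: inner_add_right inner_commute algebra_simps)
      obtain n :: nat where "s - c - inner u v < real n * (inner u y - r)"
        using reals_Archimedean3[of "inner u y - r"] r(2) by auto
      with bound[of n] show False by simp
    qed
    with 2 show ?thesis by (simp add: perspective_def)
  qed (simp add: perspective_def)
qed

text \<open>If \<open>w\<close> is a subgradient of \<open>F\<close> at \<open>p\<close> and \<open>z - p = \<gamma> w\<close>, the objective at \<open>q\<close> exceeds
  its value at \<open>p\<close> by at least \<open>\<parallel>q - p\<parallel>\<^sup>2 / 2\<close>.\<close>

lemma prox_eqI:
  fixes F :: "'a::real_inner \<Rightarrow> ereal"
  assumes "\<gamma> > 0" and ge: "\<And>q. ereal (inner w q) \<le> F q" and le: "F p \<le> ereal (inner w p)"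
    and z: "z = p + \<gamma> *\<^sub>R w"
  shows "prox (\<lambda>q. ereal \<gamma> * F q) z = p"
proof -
  define G where "G = (\<lambda>q. ereal \<gamma> * F q + ereal ((norm (z - q))\<^sup>2 / 2))"
  define m where "m = \<gamma> * inner w p + (norm (z - p))\<^sup>2 / 2"
  have "F p = ereal (inner w p)" using ge[of p] le by (rule order_antisym[rotated])
  then have Gp: "G p = ereal m" by (simp add: G_def m_def)
  have Gq: "ereal (m + (norm (q - p))\<^sup>2 / 2) \<le> G q" for q
  proof -
    \<comment> \<open>Expanding the square with \<open>z = p + \<gamma> *\<^sub>R w\<close> produces
      a cross term that cancels the dependence on \<open>inner w q\<close>.\<close>
    have "m + (norm (q - p))\<^sup>2 / 2 = \<gamma> * inner w q + (norm (z - q))\<^sup>2 / 2"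
      unfolding m_def power2_norm_eq_inner z
      by (simp add: inner_diff_left inner_diff_right inner_add_left inner_add_right
          inner_commute field_simps)
    also have "ereal \<dots> = ereal \<gamma> * ereal (inner w q) + ereal ((norm (z - q))\<^sup>2 / 2)"
      by simp
    also have "\<dots> \<le> G q"
      unfolding G_def using ge[of q] \<open>\<gamma> > 0\<close>
      by (intro add_right_mono ereal_mult_left_mono) auto
    finally show ?thesis .
  qed
  have "is_arg_min G (\<lambda>_. True) q \<longleftrightarrow> q = p" for q
  proof
    assume "is_arg_min G (\<lambda>_. True) q"
    then have "G q \<le> G p" by (auto simp: is_arg_min_def not_less)
    with Gq[of q] have "ereal (m + (norm (q - p))\<^sup>2 / 2) \<le> ereal m"
      unfolding Gp by order
    then show "q = p" by simp
  next
    have "G p \<le> G q" for q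
    proof -
      have "ereal m \<le> ereal (m + (norm (q - p))\<^sup>2 / 2)" by simp
      with Gq[of q] show ?thesis unfolding Gp by order
    qed
    moreover assume "q = p"
    ultimately show "is_arg_min G (\<lambda>_. True) q"
      by (auto simp: is_arg_min_def not_less)
  qed
  then show ?thesis
    unfolding prox_def G_def[symmetric] by (intro the_equality) auto
qed

section \<open>Even functions composed with the norm\<close>

locale even_Gamma0 =
  fixes \<phi> :: "real \<Rightarrow> ereal"
  assumes Gamma0: "\<phi> \<in> Gamma0" and even: "\<phi> (- t) = \<phi> t"
begin

lemma proper: "proper \<phi>"
  using Gamma0 by (simp add: Gamma0_def)

text \<open>The origin is the midpoint of \<open>t\<close> and \<open>- t\<close>, where
  \<open>\<phi>\<close> takes equal values.\<close>

lemma at_zero_le: "\<phi> 0 \<le> \<phi> t"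
proof -
  have cvx: "convex_ereal \<phi>" using Gamma0 by (simp add: Gamma0_def)
  have "(1 / 2 :: real) \<in> {0<..<1}" by simp
  with cvx have "\<phi> ((1 / 2) *\<^sub>R t + (1 - 1 / 2) *\<^sub>R (- t)) \<le> ereal (1 / 2) * \<phi> t + ereal (1 - 1 / 2) * \<phi> (- t)"
    unfolding convex_ereal_def by blast
  then have "\<phi> 0 \<le> ereal (1 / 2) * \<phi> t + ereal (1 / 2) * \<phi> t"
    by (simp add: even)
  then show ?thesis by (cases "\<phi> t") simp_all
qed

lemma at_zero_finite: "\<bar>\<phi> 0\<bar> \<noteq> \<infinity>"
proof -
  obtain t where "\<phi> t < \<infinity>" using proper by (auto simp: proper_def dom_def)
  with at_zero_le[of t] have "\<phi> 0 < \<infinity>" by (rule le_less_trans)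
  moreover have "\<phi> 0 \<noteq> - \<infinity>" using proper by (simp add: proper_def)
  ultimately show ?thesis by (cases "\<phi> 0") simp_all
qed

lemma proper_comp_norm: "proper (\<phi> \<circ> (norm :: 'a::real_normed_vector \<Rightarrow> real))"
proof -
  have "(0 :: 'a) \<in> dom (\<phi> \<circ> norm)"
    using at_zero_finite by (cases "\<phi> 0") (simp_all add: dom_def)
  then have "dom (\<phi> \<circ> (norm :: 'a \<Rightarrow> real)) \<noteq> {}" by blast
  then show ?thesis using proper by (simp add: proper_def)
qed

text \<open>The minimum at the origin gives a constant minorant, which serves both as a witness for
  \<open>R \<noteq> {}\<close> and as the dual point when \<open>x = 0\<close>.\<close>

lemma zero_slope_minorant: "(real_of_ereal (\<phi> 0), 0) \<in> affine_minorants \<phi>"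
proof -
  have "ereal (real_of_ereal (\<phi> 0)) = \<phi> 0"
    using at_zero_finite by (simp add: ereal_real)
  then show ?thesis using at_zero_le by (simp add: affine_minorants_def)
qed

lemma minorant_uminus:
  assumes "(c, u) \<in> affine_minorants \<phi>"
  shows "(c, - u) \<in> affine_minorants \<phi>"
proof -
  have "ereal (inner t (- u) + c) \<le> \<phi> t" for t
    using affine_minorantsD[OF assms, of "- t"] by (simp add: even)
  then show ?thesis by (simp add: affine_minorants_def)
qed

lemma minorant_abs: "(c, u) \<in> affine_minorants \<phi> \<Longrightarrow> (c, \<bar>u\<bar>) \<in> affine_minorants \<phi>"
  by (cases "u \<ge> 0") (simp_all add: minorant_uminus)

text \<open>By Cauchy--Schwarz, \<open>inner t u\<close> is at most \<open>norm t * norm u\<close>,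
  so a minorant on the line lifts to the Hilbert space.\<close>

lemma minorant_comp_norm:
  assumes "(c, norm u) \<in> affine_minorants \<phi>"
  shows "(c, u) \<in> affine_minorants (\<phi> \<circ> norm)"
proof -
  have "ereal (inner t u + c) \<le> \<phi> (norm t)" for t
  proof -
    have "ereal (inner t u + c) \<le> ereal (inner (norm t) (norm u) + c)"
      using norm_cauchy_schwarz[of t u] by simp
    also have "\<dots> \<le> \<phi> (norm t)" by (rule affine_minorantsD[OF assms])
    finally show ?thesis .
  qed
  then show ?thesis by (simp add: affine_minorants_def)
qed

text \<open>The upper counterpart of \<open>perspective_ge\<close>, tested only on minorants on the
  line: Fenchel--Moreau is applied to \<open>\<phi>\<close> itself. The number \<open>\<rho>\<close>
  is a signed length, as no sign is known for \<open>norm x - \<gamma> * \<nu>\<close> in the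
  application.\<close>

lemma perspective_comp_norm_le:
  fixes y :: "'a::real_inner"
  assumes "\<eta> \<ge> 0" and bound: "\<And>c u. (c, u) \<in> affine_minorants \<phi> \<Longrightarrow> c * \<eta> + u * \<rho> \<le> d"
    and y: "norm y = \<bar>\<rho>\<bar>"
  shows "perspective (\<phi> \<circ> norm) (\<eta>, y) \<le> ereal d"
proof -
  \<comment> \<open>Both \<open>\<bar>u\<bar>\<close> and its negative are slopes of minorants with
    the same intercept, so one of them matches the sign of \<open>\<rho>\<close>.\<close>
  have bound': "c * \<eta> + \<bar>u\<bar> * norm y \<le> d" if "(c, u) \<in> affine_minorants \<phi>" for c u
    using bound[OF minorant_abs[OF that]] bound[OF minorant_uminus[OF minorant_abs[OF that]]]
    by (auto simp: y abs_if split: if_splits)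
  show ?thesis
  proof (cases "\<eta> = 0")
    case False
    with \<open>\<eta> \<ge> 0\<close> have "\<eta> > 0" by simp
    have "\<phi> (norm (y /\<^sub>R \<eta>)) \<le> ereal (d / \<eta>)"
      unfolding Gamma0_le_iff_minorants_le[OF Gamma0]
    proof clarify
      fix c u assume "(c, u) \<in> affine_minorants \<phi>"
      from bound'[OF this] have "u * norm y + c * \<eta> \<le> d"
        using mult_right_mono[of u "\<bar>u\<bar>" "norm y", OF abs_ge_self norm_ge_zero] by linarith
      moreover have "inner (norm (y /\<^sub>R \<eta>)) u + c = (u * norm y + c * \<eta>) / \<eta>"
        using \<open>\<eta> > 0\<close> by (simp add: field_simps)
      ultimately show "inner (norm (y /\<^sub>R \<eta>)) u + c \<le> d / \<eta>"
        using \<open>\<eta> > 0\<close> by (simp only: divide_right_mono)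
    qed
    then have "ereal \<eta> * \<phi> (norm (y /\<^sub>R \<eta>)) \<le> ereal \<eta> * ereal (d / \<eta>)"
      using \<open>\<eta> > 0\<close> by (intro ereal_mult_left_mono) auto
    then show ?thesis
      using \<open>\<eta> > 0\<close> by (simp add: perspective_def)
  next
    case True
    have "\<phi> (norm (y + v)) - \<phi> (norm v) \<le> ereal d" if "v \<in> dom (\<phi> \<circ> norm)" for v
    proof -
      have "\<phi> (norm v) \<noteq> \<infinity>" "\<phi> (norm v) \<noteq> - \<infinity>"
        using that proper by (auto simp: dom_def proper_def)
      then obtain s where s: "\<phi> (norm v) = ereal s" by (cases "\<phi> (norm v)") auto
      \<comment> \<open>For each minorant the triangle inequality splits the slope term: the part
        with \<open>norm v\<close>, together with \<open>c\<close>, is at most \<open>s\<close>, and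
        the part with \<open>norm y\<close> is at most \<open>d\<close> because
        \<open>\<eta> = 0\<close> removes the intercept from \<open>bound'\<close>.\<close>
      have "\<phi> (norm (y + v)) \<le> ereal (s + d)"
        unfolding Gamma0_le_iff_minorants_le[OF Gamma0]
      proof clarify
        fix c u assume cu: "(c, u) \<in> affine_minorants \<phi>"
        have "norm (y + v) * u \<le> norm (y + v) * \<bar>u\<bar>"
          by (intro mult_left_mono) auto
        also have "\<dots> \<le> (norm y + norm v) * \<bar>u\<bar>"
          by (intro mult_right_mono norm_triangle_ineq) auto
        finally have "norm (y + v) * u \<le> \<bar>u\<bar> * norm y + norm v * \<bar>u\<bar>"
          by (simp add: algebra_simps)
        moreover have "norm v * \<bar>u\<bar> + c \<le> s"
          using affine_minorantsD[OF minorant_abs[OF cu], of "norm v"] by (simp add: s)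
        ultimately show "inner (norm (y + v)) u + c \<le> s + d"
          using bound'[OF cu] True by simp
      qed
      then show ?thesis by (cases "\<phi> (norm (y + v))") (auto simp: s)
    qed
    then show ?thesis
      using True by (simp add: perspective_def rec_def SUP_le_iff)
  qed
qed

text \<open>This is \<open>prox_eqI\<close> with \<open>w = (c, u)\<close>. The lifted minorant
  supplies the global lower bound, leaving only attainment at \<open>(\<eta>, y)\<close> to be
  checked.\<close>

lemma prox_perspective_comp_normI:
  fixes u :: "'a::real_inner"
  assumes "\<gamma> > 0" and "(c, norm u) \<in> affine_minorants \<phi>"
    and "perspective (\<phi> \<circ> norm) (\<eta>, y) \<le> ereal (c * \<eta> + inner u y)"
    and "\<sigma> = \<eta> + \<gamma> * c" "x = y + \<gamma> *\<^sub>R u"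
  shows "prox (\<lambda>z. ereal \<gamma> * perspective (\<phi> \<circ> norm) z) (\<sigma>, x) = (\<eta>, y)"
proof (rule prox_eqI[OF \<open>\<gamma> > 0\<close>])
  show "ereal (inner (c, u) q) \<le> perspective (\<phi> \<circ> norm) q" for q
  proof (cases q)
    case (Pair \<eta>' y')
    show ?thesis
      unfolding Pair inner_Pair inner_real_def
      by (rule perspective_ge[OF proper_comp_norm minorant_comp_norm[OF assms(2)]])
  qed
  show "perspective (\<phi> \<circ> norm) (\<eta>, y) \<le> ereal (inner (c, u) (\<eta>, y))"
    unfolding inner_Pair inner_real_def by (rule assms(3))
  show "(\<sigma>, x) = (\<eta>, y) + \<gamma> *\<^sub>R (c, u)"
    by (simp add: assms(4,5))
qed

end

section \<open>The set \<open>R\<close> and the three proximal formulas\<close>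

theorem proposition2p3:
  fixes \<phi> :: "real \<Rightarrow> ereal"
    and \<phi>H :: "'a::{real_inner, complete_space} \<Rightarrow> ereal"
    and \<gamma> \<sigma> :: real
    and x :: 'a
    and R :: "(real \<times> real) set"
  assumes phi: "\<phi> \<in> Gamma0"
    and even: "\<And>t. \<phi> (- t) = \<phi> t"
    and phiH: "\<phi>H = \<phi> \<circ> norm"
    and gamma: "\<gamma> > 0"
    and R: "R = {(\<xi>, \<nu>). ereal \<xi> + conjugate \<phi> \<nu> \<le> 0}"
  shows "R \<noteq> {} \<and> closed R \<and> convex R
    \<and> (ereal \<sigma> + ereal \<gamma> * conjugate \<phi> (norm x / \<gamma>) \<le> 0
        \<longrightarrow> prox (\<lambda>z. ereal \<gamma> * perspective \<phi>H z) (\<sigma>, x) = (0, 0))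
    \<and> (ereal \<sigma> > ereal \<gamma> * \<phi> 0 \<and> x = 0
        \<longrightarrow> prox (\<lambda>z. ereal \<gamma> * perspective \<phi>H z) (\<sigma>, x)
            = (\<sigma> - \<gamma> * real_of_ereal (\<phi> 0), x))
    \<and> (ereal \<sigma> + ereal \<gamma> * conjugate \<phi> (norm x / \<gamma>) > 0 \<and> x \<noteq> 0
        \<longrightarrow> (\<forall>\<xi> \<nu>. (\<xi>, \<nu>) = closest_point R (\<sigma> / \<gamma>, norm x / \<gamma>)
            \<longrightarrow> prox (\<lambda>z. ereal \<gamma> * perspective \<phi>H z) (\<sigma>, x)
                = (\<sigma> - \<gamma> * \<xi>, (1 - \<gamma> * \<nu> / norm x) *\<^sub>R x)))"
proof -
  interpret even_Gamma0 \<phi>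
    using phi even by (rule even_Gamma0.intro)
  have R_eq: "R = affine_minorants \<phi>"
    unfolding R add_conjugate_nonpos_iff by simp
  have Rne: "R \<noteq> {}" using zero_slope_minorant by (auto simp: R_eq)
  have Rcl: "closed R" and Rcv: "convex R"
    by (simp_all add: R_eq closed_affine_minorants convex_affine_minorants)
  have scaled: "ereal \<sigma> + ereal \<gamma> * conjugate \<phi> (norm x / \<gamma>) \<le> 0
      \<longleftrightarrow> (\<sigma> / \<gamma>, norm x / \<gamma>) \<in> affine_minorants \<phi>"
    unfolding add_conjugate_nonpos_iff[symmetric] using gamma
    by (cases "conjugate \<phi> (norm x / \<gamma>)") (auto simp: field_simps)
  have i: "prox (\<lambda>z. ereal \<gamma> * perspective \<phi>H z) (\<sigma>, x) = (0, 0)"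
    if "ereal \<sigma> + ereal \<gamma> * conjugate \<phi> (norm x / \<gamma>) \<le> 0"
    unfolding phiH
  \<comment> \<open>For the proximal point zero the dual point must be \<open>(\<sigma>, x)\<close>
    divided by \<open>\<gamma>\<close>; attainment amounts to the recession function being at most 0
    at the origin.\<close>
  proof (rule prox_perspective_comp_normI[where c = "\<sigma> / \<gamma>" and u = "x /\<^sub>R \<gamma>"])
    have "norm (x /\<^sub>R \<gamma>) = norm x / \<gamma>"
      using gamma by (simp add: divide_inverse)
    with that show "(\<sigma> / \<gamma>, norm (x /\<^sub>R \<gamma>)) \<in> affine_minorants \<phi>"
      by (simp only: scaled)
    have "perspective (\<phi> \<circ> norm) (0, 0 :: 'a) = rec (\<phi> \<circ> norm) (0 :: 'a)"
      by (simp add: perspective_def)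
    also have "\<dots> \<le> 0"
      unfolding rec_def
    proof (rule SUP_least)
      fix v :: 'a assume "v \<in> dom (\<phi> \<circ> norm)"
      then show "(\<phi> \<circ> norm) (0 + v) - (\<phi> \<circ> norm) v \<le> 0"
        using proper_comp_norm[where 'a = 'a]
        by (cases "\<phi> (norm v)") (auto simp: dom_def proper_def)
    qed
    finally show "perspective (\<phi> \<circ> norm) (0, 0 :: 'a)
        \<le> ereal (\<sigma> / \<gamma> * 0 + inner (x /\<^sub>R \<gamma>) 0)"
      by (simp add: zero_ereal_def)
  qed (use gamma in auto)
  have ii: "prox (\<lambda>z. ereal \<gamma> * perspective \<phi>H z) (\<sigma>, x) = (\<sigma> - \<gamma> * real_of_ereal (\<phi> 0), x)"
    if "ereal \<sigma> > ereal \<gamma> * \<phi> 0" "x = 0"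
  proof -
    obtain s where s: "\<phi> 0 = ereal s" using at_zero_finite by auto
    \<comment> \<open>Positivity selects the first branch of the perspective, whose value at the
      zero vector is the pairing with the dual point \<open>(s, 0)\<close>.\<close>
    then have "\<sigma> - \<gamma> * s > 0" using that(1) by simp
    then have "perspective (\<phi> \<circ> norm) (\<sigma> - \<gamma> * s, 0 :: 'a) = ereal (s * (\<sigma> - \<gamma> * s))"
      by (simp add: perspective_def s mult.commute)
    then show ?thesis
      unfolding phiH using gamma that(2) zero_slope_minorant s
      by (intro prox_perspective_comp_normI[where c = s and u = 0]) auto
  qed
  have iii: "prox (\<lambda>z. ereal \<gamma> * perspective \<phi>H z) (\<sigma>, x)
      = (\<sigma> - \<gamma> * \<xi>, (1 - \<gamma> * \<nu> / norm x) *\<^sub>R x)"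
    if "x \<noteq> 0" and proj: "(\<xi>, \<nu>) = closest_point R (\<sigma> / \<gamma>, norm x / \<gamma>)" for \<xi> \<nu>
  proof -
    have mem: "(\<xi>, \<nu>) \<in> affine_minorants \<phi>"
      using closest_point_in_set[OF Rcl Rne] unfolding proj R_eq .
    have normal: "(\<sigma> / \<gamma> - \<xi>) * (c - \<xi>) + (norm x / \<gamma> - \<nu>) * (u - \<nu>) \<le> 0"
      if "(c, u) \<in> affine_minorants \<phi>" for c u
      using closest_point_dot[OF Rcv Rcl, of "(c, u)" "(\<sigma> / \<gamma>, norm x / \<gamma>)"] that
      unfolding proj[symmetric] by (simp add: R_eq)
    \<comment> \<open>Lowering the intercept keeps a minorant, and the normal inequality in this
      vertical direction gives the sign of \<open>\<sigma> / \<gamma> - \<xi>\<close>.\<close>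
    have "(\<xi> - 1, \<nu>) \<in> affine_minorants \<phi>"
      unfolding affine_minorants_def
    proof clarify
      fix t
      have "ereal (inner t \<nu> + (\<xi> - 1)) \<le> ereal (inner t \<nu> + \<xi>)" by simp
      also have "\<dots> \<le> \<phi> t" by (rule affine_minorantsD[OF mem])
      finally show "ereal (inner t \<nu> + (\<xi> - 1)) \<le> \<phi> t" .
    qed
    from normal[OF this] have eta: "\<sigma> - \<gamma> * \<xi> \<ge> 0"
      using gamma by (simp add: field_simps)
    \<comment> \<open>The unit vector \<open>e\<close> carries the slope \<open>\<nu>\<close> to
      \<open>\<nu> *\<^sub>R e\<close>, whose norm is \<open>\<bar>\<nu>\<bar>\<close>; hence the
      use of \<open>minorant_abs\<close> below.\<close>
    define e where "e = (1 / norm x) *\<^sub>R x"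
    have e: "norm e = 1" "x = norm x *\<^sub>R e" using \<open>x \<noteq> 0\<close> by (simp_all add: e_def)
    have y: "(1 - \<gamma> * \<nu> / norm x) *\<^sub>R x = (norm x - \<gamma> * \<nu>) *\<^sub>R e"
      using \<open>x \<noteq> 0\<close> by (simp add: e_def divide_simps)
    have "prox (\<lambda>z. ereal \<gamma> * perspective \<phi>H z) (\<sigma>, x)
        = (\<sigma> - \<gamma> * \<xi>, (norm x - \<gamma> * \<nu>) *\<^sub>R e)"
      unfolding phiH
    proof (rule prox_perspective_comp_normI[where c = \<xi> and u = "\<nu> *\<^sub>R e"])
      show "(\<xi>, norm (\<nu> *\<^sub>R e)) \<in> affine_minorants \<phi>"
        using minorant_abs[OF mem] by (simp add: e(1))
      show "perspective (\<phi> \<circ> norm) (\<sigma> - \<gamma> * \<xi>, (norm x - \<gamma> * \<nu>) *\<^sub>R e)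
          \<le> ereal (\<xi> * (\<sigma> - \<gamma> * \<xi>) + inner (\<nu> *\<^sub>R e) ((norm x - \<gamma> * \<nu>) *\<^sub>R e))"
      \<comment> \<open>Both \<open>\<sigma> - \<gamma> * \<xi>\<close> and
        \<open>norm x - \<gamma> * \<nu>\<close> are \<open>\<gamma>\<close> times the residuals of
        the projection, so the normal inequality says that \<open>(\<xi>, \<nu>)\<close> maximizes
        the pairing with them over all minorants.\<close>
      proof (rule perspective_comp_norm_le[OF eta, where \<rho> = "norm x - \<gamma> * \<nu>"])
        fix c u assume "(c, u) \<in> affine_minorants \<phi>"
        have "(\<sigma> - \<gamma> * \<xi>) * (c - \<xi>) + (norm x - \<gamma> * \<nu>) * (u - \<nu>)
            = \<gamma> * ((\<sigma> / \<gamma> - \<xi>) * (c - \<xi>) + (norm x / \<gamma> - \<nu>) * (u - \<nu>))"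
          using gamma by (simp add: field_simps)
        also have "\<dots> \<le> 0"
          using gamma normal[OF \<open>(c, u) \<in> affine_minorants \<phi>\<close>] by (simp add: mult_nonneg_nonpos)
        finally have "(\<sigma> - \<gamma> * \<xi>) * (c - \<xi>) + (norm x - \<gamma> * \<nu>) * (u - \<nu>) \<le> 0" .
        moreover have "inner e e = 1" using e(1) by (simp add: norm_eq_1)
        ultimately show "c * (\<sigma> - \<gamma> * \<xi>) + u * (norm x - \<gamma> * \<nu>)
            \<le> \<xi> * (\<sigma> - \<gamma> * \<xi>) + inner (\<nu> *\<^sub>R e) ((norm x - \<gamma> * \<nu>) *\<^sub>R e)"
          by (simp add: algebra_simps)
      qed (simp add: e(1))
      show "x = (norm x - \<gamma> * \<nu>) *\<^sub>R e + \<gamma> *\<^sub>R \<nu> *\<^sub>R e"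
        by (subst e(2)) (simp add: algebra_simps)
    qed (use gamma in auto)
    then show ?thesis by (simp only: y)
  qed
  show ?thesis
    using Rne Rcl Rcv i ii iii by blast
qed

end
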